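(* Let $f:\mathbb{R}\to\mathbb{R}$ be smooth and assume there is $a\in(0,1)$ such that $f(0)=f(a)=f(1)=0$, $f<0$ on $(0,a)$, $f>0$ on $(a,1)$, $f'(0)<0$, $f'(1)<0$, $f'(a)>0$ and $\int_0^1 f(u)\,\mathrm{d}u>0$. Let $\mathcal{K}:\mathbb{R}\to\mathbb{R}$ satisfy: $\mathcal{K},\mathcal{K}'\in L^1(\mathbb{R})$, $\int_{\mathbb{R}}\mathcal{K}(x)\,\mathrm{d}x=1$; $0\le \mathcal{K}(x)=\mathcal{K}(-x)<+\infty$ for all $x\in\mathbb{R}$; and $\int_{\mathbb{R}}\mathcal{K}(x)|x|\,\mathrm{d}x<+\infty$. Set $\kappa:=\sup_{u\in(a,1)}\frac{f(u)}{u}>0$. If $d>\kappa$, then there exists $\ell_0>0$ such that for all $\ell\in(0,\ell_0)$ the solution $u_\ell$ of the Cauchy problem $$\partial_t u = d(-u+\mathcal{K}*u)+f(u),\quad t>0,\ x\in\mathbb{R},\qquad u(0,x)=\mathbf{1}_{[-\ell,\ell]}(x),\quad x\in\mathbb{R},$$ satisfies $u_\ell(t,x)\to 0$ as $t\to+\infty$, uniformly in $x\in\mathbb{R}$.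
   Context: $\mathcal{K}*u(t,\cdot)$ denotes convolution on the real line in the space variable. Under the stated hypotheses on $f$ and $\mathcal{K}$, for every $d>0$ and $\ell>0$ the Cauchy problem has a unique global solution $u_\ell\in\mathscr{C}^1((0,+\infty),L^1(\mathbb{R})\cap L^\infty(\mathbb{R}))\cap\mathscr{C}^0([0,+\infty),L^1(\mathbb{R})\cap L^\infty(\mathbb{R}))$, and this is what "the solution" refers to. *)

theory Defs
  imports "HOL-Probability.Essential_Supremum"
begin

definition smooth :: "(real \<Rightarrow> real) \<Rightarrow> bool" where
  "smooth f \<longleftrightarrow> (\<forall>n. (deriv ^^ n) f differentiable_on UNIV)"

text \<open>
  The derivative of the kernel is taken in the weak sense, so that a kernel such as
  \<open>exp (- \<bar>x\<bar>) / 2\<close> is allowed. The test functions are the \<open>C\<^sup>1\<close> functions with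
  compact support, as is usual for Sobolev spaces in one dimension.
\<close>

definition weak_derivative :: "(real \<Rightarrow> real) \<Rightarrow> (real \<Rightarrow> real) \<Rightarrow> bool" where
  "weak_derivative g g' \<longleftrightarrow>
    (\<forall>\<phi>. \<phi> C1_differentiable_on UNIV \<and> compact (closure {x. \<phi> x \<noteq> 0}) \<longrightarrow>
      (LINT x|lebesgue. g x * deriv \<phi> x) = - (LINT x|lebesgue. g' x * \<phi> x))"

definition convolve :: "(real \<Rightarrow> real) \<Rightarrow> (real \<Rightarrow> real) \<Rightarrow> real \<Rightarrow> real" where
  "convolve g h x = (LINT y|lebesgue. g (x - y) * h y)"

text \<open>
  The norm of \<open>L\<^sup>1(\<real>) \<inter> L\<^sup>\<infinity>(\<real>)\<close>, with value \<open>\<infinity>\<close> outside this space. Elements of the space are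
  represented by functions, which count as equal when they agree almost everywhere.
\<close>

definition norm_L1_Linf :: "(real \<Rightarrow> real) \<Rightarrow> ennreal" where
  "norm_L1_Linf g =
    (\<integral>\<^sup>+x. ennreal \<bar>g x\<bar> \<partial>lebesgue) + esssup lebesgue (\<lambda>x. ennreal \<bar>g x\<bar>)"

definition L1_Linf :: "(real \<Rightarrow> real) set" where
  "L1_Linf = {g \<in> borel_measurable lebesgue. norm_L1_Linf g < \<infinity>}"

definition L1_Linf_continuous_on :: "real set \<Rightarrow> (real \<Rightarrow> real \<Rightarrow> real) \<Rightarrow> bool" where
  "L1_Linf_continuous_on T w \<longleftrightarrow>
    (\<forall>t\<in>T. w t \<in> L1_Linf) \<and>
    (\<forall>t\<in>T. ((\<lambda>s. norm_L1_Linf (\<lambda>x. w s x - w t x)) \<longlongrightarrow> 0) (at t within T))"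

definition has_L1_Linf_derivative ::
    "(real \<Rightarrow> real \<Rightarrow> real) \<Rightarrow> (real \<Rightarrow> real) \<Rightarrow> real \<Rightarrow> bool" where
  "has_L1_Linf_derivative w w' t \<longleftrightarrow>
    ((\<lambda>h. norm_L1_Linf (\<lambda>x. (w (t + h) x - w t x) / h - w' x)) \<longlongrightarrow> 0) (at 0)"

text \<open>
  \<open>u t x\<close> solves \<open>\<partial>\<^sub>t u = d (- u + K * u) + f(u)\<close> with initial datum \<open>u\<^sub>0\<close>, in the class
  \<open>C\<^sup>1((0,\<infinity>), L\<^sup>1 \<inter> L\<^sup>\<infinity>) \<inter> C\<^sup>0([0,\<infinity>), L\<^sup>1 \<inter> L\<^sup>\<infinity>)\<close>; \<open>v\<close> is the time derivative, and equations
  between elements of \<open>L\<^sup>1 \<inter> L\<^sup>\<infinity>\<close> hold almost everywhere. The values \<open>u t\<close> for \<open>t < 0\<close> are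
  irrelevant.
\<close>

definition cauchy_solution ::
    "real \<Rightarrow> (real \<Rightarrow> real) \<Rightarrow> (real \<Rightarrow> real) \<Rightarrow> (real \<Rightarrow> real) \<Rightarrow> (real \<Rightarrow> real \<Rightarrow> real) \<Rightarrow> bool"
  where
  "cauchy_solution d K f u\<^sub>0 u \<longleftrightarrow>
    L1_Linf_continuous_on {0..} u \<and>
    (AE x in lebesgue. u 0 x = u\<^sub>0 x) \<and>
    (\<exists>v. L1_Linf_continuous_on {0<..} v \<and>
      (\<forall>t>0. has_L1_Linf_derivative u (v t) t) \<and>
      (\<forall>t>0. AE x in lebesgue. v t x = d * (- u t x + convolve K (u t) x) + f (u t x)))"

end

theory Submission
  imports Defs
begin

text \<open>
  An affine function of \<open>t\<close> whose slope strictly exceeds the right-hand side of the equation is a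
  barrier for the essential supremum of \<open>u\<close>. The constants \<open>1 + \<epsilon>\<close> and \<open>- \<epsilon>\<close> are barriers, so
  \<open>0 \<le> u \<le> 1\<close>; hence \<open>f(u) \<le> \<kappa> u\<close>, and the mass of \<open>u\<close> at time \<open>t\<close> is at most \<open>2 l exp (\<kappa> t)\<close>.
  Splitting \<open>K\<close> into \<open>min K n\<close> and a remainder of small integral shows that on a fixed interval
  \<open>[0, T]\<close> the convolution \<open>K * u\<close> is uniformly as small as we like once \<open>l\<close> is small. The
  equation is then close to \<open>\<partial>\<^sub>t u \<le> - (d - \<kappa>) u\<close>, so that a decreasing affine barrier brings \<open>u\<close>
  below \<open>a / 2\<close> at time \<open>T\<close>. Below \<open>a\<close> the reaction is negative, and further affine barriers bring
  \<open>u\<close> below every \<open>\<epsilon> > 0\<close> and keep it there.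
\<close>

section \<open>The space of integrable bounded functions\<close>

text \<open>The essential supremum is one summand of the norm. Convergence in
  \<open>norm_L1_Linf\<close> is used below through this bound and, for the other summand, through
  \<open>integral_bound_if_norm_less\<close>.\<close>

lemma AE_bound_if_norm_less:
  assumes "norm_L1_Linf w < ennreal e"
  shows "AE x in lebesgue. \<bar>w x\<bar> < e"
proof -
  have "esssup lebesgue (\<lambda>x. ennreal \<bar>w x\<bar>) < ennreal e"
    using assms unfolding norm_L1_Linf_def
    by (meson le_less_trans le_iff_add add.commute order_refl dual_order.trans zero_le add_increasing)
  with esssup_AE[of "\<lambda>x. ennreal \<bar>w x\<bar>" lebesgue] show ?thesis
    by (auto elim!: eventually_mono dest!: le_less_trans simp: ennreal_less_iff)
qed

lemma L1_Linf_integrable: "w \<in> L1_Linf \<Longrightarrow> integrable lebesgue w"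
  unfolding L1_Linf_def norm_L1_Linf_def integrable_iff_bounded
  by (auto simp: less_top)

lemma L1_Linf_AE_bounded:
  assumes "w \<in> L1_Linf"
  obtains R where "0 < R" "AE x in lebesgue. \<bar>w x\<bar> \<le> R"
proof -
  obtain r where r: "norm_L1_Linf w = ennreal r" "0 \<le> r"
    using assms by (cases "norm_L1_Linf w") (auto simp: L1_Linf_def)
  then have "norm_L1_Linf w < ennreal (r + 1)"
    by (simp add: ennreal_less_iff)
  from AE_bound_if_norm_less[OF this] r(2) show ?thesis
    by (intro that[of "r + 1"]) (auto elim: eventually_mono)
qed

lemma integral_bound_if_norm_less:
  assumes "integrable lebesgue w" "norm_L1_Linf w < ennreal e"
  shows "\<bar>LINT x|lebesgue. w x\<bar> < e"
proof -
  have "ennreal (LINT x|lebesgue. \<bar>w x\<bar>) = (\<integral>\<^sup>+x. ennreal \<bar>w x\<bar> \<partial>lebesgue)"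
    using assms(1) by (intro nn_integral_eq_integral[symmetric]) auto
  also have "\<dots> \<le> norm_L1_Linf w"
    unfolding norm_L1_Linf_def by (simp add: add_increasing2)
  also note assms(2)
  finally have "(LINT x|lebesgue. \<bar>w x\<bar>) < e"
    by (simp add: ennreal_less_iff)
  moreover have "\<bar>LINT x|lebesgue. w x\<bar> \<le> (LINT x|lebesgue. \<bar>w x\<bar>)"
    by (rule integral_abs_bound)
  ultimately show ?thesis by linarith
qed

text \<open>Stability under negation allows lower bounds on \<open>u\<close> to be read off from
  upper bounds on \<open>- u\<close>.\<close>

lemma norm_L1_Linf_uminus: "norm_L1_Linf (\<lambda>x. - w x) = norm_L1_Linf w"
  by (simp add: norm_L1_Linf_def)

lemma L1_Linf_uminus: "w \<in> L1_Linf \<Longrightarrow> (\<lambda>x. - w x) \<in> L1_Linf"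
  by (auto simp: L1_Linf_def norm_L1_Linf_uminus)

lemma L1_Linf_continuous_on_uminus:
  assumes "L1_Linf_continuous_on T w"
  shows "L1_Linf_continuous_on T (\<lambda>t x. - w t x)"
proof -
  have "norm_L1_Linf (\<lambda>x. - w s x - - w t x) = norm_L1_Linf (\<lambda>x. w s x - w t x)" for s t
    using norm_L1_Linf_uminus[of "\<lambda>x. w s x - w t x"] by simp
  then show ?thesis
    using assms by (simp add: L1_Linf_continuous_on_def L1_Linf_uminus)
qed

lemma has_L1_Linf_derivative_uminus:
  assumes "has_L1_Linf_derivative w w' t"
  shows "has_L1_Linf_derivative (\<lambda>t x. - w t x) (\<lambda>x. - w' x) t"
proof -
  have "(\<lambda>x. (- w (t + h) x - - w t x) / h - - w' x) = (\<lambda>x. - ((w (t + h) x - w t x) / h - w' x))" for h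
    by (auto simp: diff_divide_distrib)
  then show ?thesis
    using assms unfolding has_L1_Linf_derivative_def by (simp only: norm_L1_Linf_uminus)
qed

lemma L1_Linf_continuous_on_subset:
  assumes "L1_Linf_continuous_on T w" "S \<subseteq> T"
  shows "L1_Linf_continuous_on S w"
  using assms unfolding L1_Linf_continuous_on_def by (meson subsetD tendsto_within_subset)

text \<open>Integration is a bounded linear functional for this norm, so it commutes with the time
  derivative. Integrability is required only near \<open>t\<close>, since solutions are
  unconstrained at negative times.\<close>

lemma has_real_derivative_integral:
  assumes deriv: "has_L1_Linf_derivative w w' t" and w': "integrable lebesgue w'"
    and w: "\<forall>\<^sub>F s in nhds t. integrable lebesgue (w s)"
  shows "((\<lambda>s. LINT x|lebesgue. w s x) has_real_derivative (LINT x|lebesgue. w' x)) (at t)"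
  unfolding DERIV_def
proof (rule tendstoI)
  fix e :: real assume "e > 0"
  have wt: "integrable lebesgue (w t)" using w by (rule eventually_nhds_x_imp_x)
  have "((\<lambda>h. t + h) \<longlongrightarrow> t) (at 0)" by (rule tendsto_eq_intros refl | simp)+
  with w have ev: "\<forall>\<^sub>F h in at 0. integrable lebesgue (w (t + h))"
    by (rule eventually_compose_filterlim)
  have "\<forall>\<^sub>F h in at 0. norm_L1_Linf (\<lambda>x. (w (t + h) x - w t x) / h - w' x) < ennreal e"
    using deriv \<open>e > 0\<close> unfolding has_L1_Linf_derivative_def by (intro order_tendstoD(2)) auto
  with ev show "\<forall>\<^sub>F h in at 0. dist (((LINT x|lebesgue. w (t + h) x) - (LINT x|lebesgue. w t x)) / h)
      (LINT x|lebesgue. w' x) < e"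
  proof eventually_elim
    case (elim h)
    then have "\<bar>LINT x|lebesgue. (w (t + h) x - w t x) / h - w' x\<bar> < e"
      using wt w' by (intro integral_bound_if_norm_less) auto
    then show ?case using elim(1) wt w' by (simp add: dist_real_def)
  qed
qed

lemma continuous_on_integral:
  assumes "L1_Linf_continuous_on T w"
  shows "continuous_on T (\<lambda>t. LINT x|lebesgue. w t x)"
  unfolding continuous_on_def
proof (intro ballI tendstoI)
  fix t and e :: real assume t: "t \<in> T" and "e > 0"
  have int: "integrable lebesgue (w s)" if "s \<in> T" for s
    using assms that by (intro L1_Linf_integrable) (auto simp: L1_Linf_continuous_on_def)
  have "\<forall>\<^sub>F s in at t within T. norm_L1_Linf (\<lambda>x. w s x - w t x) < ennreal e"
    using assms t \<open>e > 0\<close> unfolding L1_Linf_continuous_on_def by (intro order_tendstoD(2)) auto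
  moreover have "\<forall>\<^sub>F s in at t within T. s \<in> T" by (auto simp: eventually_at_filter)
  ultimately show "\<forall>\<^sub>F s in at t within T. dist (LINT x|lebesgue. w s x) (LINT x|lebesgue. w t x) < e"
  proof eventually_elim
    case (elim s)
    then have "\<bar>LINT x|lebesgue. w s x - w t x\<bar> < e"
      using int t by (intro integral_bound_if_norm_less) auto
    then show ?case using elim int t by (simp add: dist_real_def)
  qed
qed

section \<open>Affine barriers\<close>

text \<open>Let \<open>m\<close> be the supremum of the times up to which \<open>P\<close> holds
  throughout. Then \<open>left\<close> carries \<open>P\<close> to \<open>m\<close>, and
  \<open>right\<close> contradicts \<open>m < T\<close>.\<close>

lemma real_interval_induct [consumes 1, case_names start left right]:
  fixes P :: "real \<Rightarrow> bool"
  assumes "s \<le> T"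
    and start: "P s"
    and left: "\<And>t. \<lbrakk>s < t; t \<le> T; \<And>r. \<lbrakk>s \<le> r; r < t\<rbrakk> \<Longrightarrow> P r\<rbrakk> \<Longrightarrow> P t"
    and right: "\<And>t. \<lbrakk>s \<le> t; t < T; P t\<rbrakk> \<Longrightarrow> \<exists>\<delta>>0. \<forall>r. t < r \<and> r < t + \<delta> \<longrightarrow> P r"
  shows "P T"
proof -
  define S where "S = {t. s \<le> t \<and> t \<le> T \<and> (\<forall>r. s \<le> r \<and> r \<le> t \<longrightarrow> P r)}"
  define m where "m = Sup S"
  have bdd: "bdd_above S" unfolding S_def by auto
  have sS: "s \<in> S" using assms(1) start by (auto simp: S_def)
  have sm: "s \<le> m" unfolding m_def by (rule cSup_upper[OF sS bdd])
  have mT: "m \<le> T" unfolding m_def by (rule cSup_least) (use sS in \<open>auto simp: S_def\<close>)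
  have below: "P r" if "s \<le> r" "r < m" for r
  proof -
    obtain t where "t \<in> S" "r < t"
      using \<open>r < m\<close> less_cSup_iff[OF _ bdd] sS unfolding m_def by blast
    then show ?thesis using that by (auto simp: S_def)
  qed
  have Pm: "P m"
    using left[OF _ mT below] sm start by (cases "s = m") auto
  have "m = T"
  proof (rule ccontr)
    assume "m \<noteq> T"
    with mT have "m < T" by simp
    from right[OF sm this Pm] obtain \<delta> where d: "\<delta> > 0" "\<And>r. m < r \<Longrightarrow> r < m + \<delta> \<Longrightarrow> P r"
      by blast
    \<comment> \<open>The minimum keeps \<open>t\<close> inside the interval while still exceeding
      \<open>m\<close>.\<close>
    define t where "t = min T (m + \<delta> / 2)"
    have t: "m < t" "t < m + \<delta>" "t \<le> T" using d(1) \<open>m < T\<close> by (auto simp: t_def min_def)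
    have "P r" if "s \<le> r" "r \<le> t" for r
      using below[of r] Pm d(2)[of r] that t by (cases r m rule: linorder_cases) auto
    then have "t \<in> S" using t sm by (auto simp: S_def)
    then have "t \<le> m" unfolding m_def by (rule cSup_upper[OF _ bdd])
    with t show False by simp
  qed
  with Pm show ?thesis by simp
qed

text \<open>Countably many margins tending to 0 suffice, and only countably many exceptional null
  sets may be united. The cap \<open>e\<^sub>0 / 2\<close> keeps each margin in the admissible
  range.\<close>

lemma AE_le_if_le_add:
  fixes w :: "'a \<Rightarrow> real"
  assumes "0 < e\<^sub>0" and le: "\<And>e. \<lbrakk>0 < e; e < e\<^sub>0\<rbrakk> \<Longrightarrow> AE x in M. w x \<le> B + e"
  shows "AE x in M. w x \<le> B"
proof -
  have "AE x in M. w x \<le> B + min (e\<^sub>0 / 2) (1 / Suc n)" for n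
    using \<open>0 < e\<^sub>0\<close> by (intro le) auto
  then have "AE x in M. \<forall>n. w x \<le> B + min (e\<^sub>0 / 2) (1 / Suc n)"
    by (simp add: AE_all_countable)
  then show ?thesis
  proof eventually_elim
    case (elim x)
    show ?case
    proof (rule field_le_epsilon)
      fix e :: real assume "e > 0"
      then obtain n where "1 / Suc n < e" using nat_approx_posE by blast
      with elim[rule_format, of n] show "w x \<le> B + e" by linarith
    qed
  qed
qed

text \<open>There need be no point of first contact, so the inequality is propagated in time by real
  induction: it survives limits from the left, and a short Euler step carries it to the right. In
  \<open>rate\<close> the bound on \<open>v\<close> is asked for only while the barrier holds, so
  that it may itself rest on the barrier.\<close>

lemma affine_barrier:
  fixes u v :: "real \<Rightarrow> real \<Rightarrow> real" and b c s T :: real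
  defines "\<beta> \<equiv> \<lambda>t. b + c * (t - s)"
  assumes cont: "L1_Linf_continuous_on {s..} u"
    and deriv: "\<And>t. s < t \<Longrightarrow> has_L1_Linf_derivative u (v t) t"
    and g_lipschitz: "\<And>R. \<exists>L. \<forall>y z. \<bar>y\<bar> \<le> R \<and> \<bar>z\<bar> \<le> R \<longrightarrow> \<bar>g y - g z\<bar> \<le> L * \<bar>y - z\<bar>"
    and init: "b' < b" "AE x in lebesgue. u s x \<le> b'"
    and rate: "\<And>t. \<lbrakk>s < t; t < T; AE x in lebesgue. u t x \<le> \<beta> t\<rbrakk>
          \<Longrightarrow> k t + g (\<beta> t) < c \<and> (AE x in lebesgue. v t x \<le> k t + g (u t x))"
    and "s \<le> T"
  shows "AE x in lebesgue. u T x \<le> \<beta> T"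
  using \<open>s \<le> T\<close>
proof (induction rule: real_interval_induct)
  case start
  show ?case using init(2) by eventually_elim (use init(1) in \<open>simp add: \<beta>_def\<close>)
next
  case (left t)
  have "((\<lambda>r. norm_L1_Linf (\<lambda>x. u r x - u t x)) \<longlongrightarrow> 0) (at t within {s..})"
    using cont left(1) by (auto simp: L1_Linf_continuous_on_def)
  then have lim: "((\<lambda>r. norm_L1_Linf (\<lambda>x. u r x - u t x)) \<longlongrightarrow> 0) (at_left t)"
    using left(1) by (subst (asm) at_within_interior) (auto intro: tendsto_mono[OF at_le])
  \<comment> \<open>A single earlier time \<open>r\<close> suffices for each \<open>e\<close>: one
    margin pays for the change of \<open>u\<close>, the other for that of
    \<open>\<beta>\<close>.\<close>
  have near: "AE x in lebesgue. u t x \<le> \<beta> t + 2 * e" if "0 < e" for e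
  proof -
    have ev1: "\<forall>\<^sub>F r in at_left t. norm_L1_Linf (\<lambda>x. u r x - u t x) < ennreal e"
      using order_tendstoD(2)[OF lim] \<open>e > 0\<close> by simp
    have "isCont \<beta> t" unfolding \<beta>_def by (intro continuous_intros)
    then have "(\<beta> \<longlongrightarrow> \<beta> t) (at_left t)"
      by (auto simp: isCont_def intro: tendsto_mono[OF at_le])
    then have ev2: "\<forall>\<^sub>F r in at_left t. \<beta> r < \<beta> t + e"
      using \<open>e > 0\<close> by (intro order_tendstoD(2)) auto
    have ev3: "\<forall>\<^sub>F r in at_left t. s < r \<and> r < t"
      using left(1) by (auto simp: eventually_at_left intro: exI[of _ s])
    obtain r where r: "norm_L1_Linf (\<lambda>x. u r x - u t x) < ennreal e" "\<beta> r < \<beta> t + e" "s < r" "r < t"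
      using eventually_happens[OF eventually_conj[OF ev1 eventually_conj[OF ev2 ev3]]] by auto
    have "AE x in lebesgue. u r x \<le> \<beta> r" using left(3)[of r] r by simp
    with AE_bound_if_norm_less[OF r(1)] show ?thesis
    proof eventually_elim
      case (elim x)
      with r(2) show ?case unfolding abs_less_iff by linarith
    qed
  qed
  show ?case
  proof (rule AE_le_if_le_add[where e\<^sub>0 = 1])
    show "AE x in lebesgue. u t x \<le> \<beta> t + e" if "0 < e" for e
      using near[of "e / 2"] that by simp
  qed simp
next
  case (right t)
  show ?case
  proof (cases "t = s")
    case True
    \<comment> \<open>At the initial time no derivative is available. The gap between
      \<open>b'\<close> and \<open>b\<close> is spent instead, half on the change of
      \<open>u\<close> and half on that of \<open>\<beta>\<close>.\<close>
    define e where "e = (b - b') / 2"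
    have "e > 0" using init(1) by (simp add: e_def)
    have "((\<lambda>r. norm_L1_Linf (\<lambda>x. u r x - u s x)) \<longlongrightarrow> 0) (at s within {s..})"
      using cont by (auto simp: L1_Linf_continuous_on_def)
    then have lim: "((\<lambda>r. norm_L1_Linf (\<lambda>x. u r x - u s x)) \<longlongrightarrow> 0) (at_right s)"
      by (rule tendsto_mono[OF at_le, rotated]) auto
    have ev1: "\<forall>\<^sub>F r in at_right s. norm_L1_Linf (\<lambda>x. u r x - u s x) < ennreal e"
      using order_tendstoD(2)[OF lim] \<open>e > 0\<close> by simp
    have "isCont \<beta> s" unfolding \<beta>_def by (intro continuous_intros)
    then have "(\<beta> \<longlongrightarrow> \<beta> s) (at_right s)"
      by (auto simp: isCont_def intro: tendsto_mono[OF at_le])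
    then have ev2: "\<forall>\<^sub>F r in at_right s. \<beta> s - e < \<beta> r"
      using \<open>e > 0\<close> by (intro order_tendstoD(1)) auto
    from eventually_conj[OF ev1 ev2] obtain z where z: "z > s"
      "\<And>r. s < r \<Longrightarrow> r < z \<Longrightarrow> norm_L1_Linf (\<lambda>x. u r x - u s x) < ennreal e \<and> \<beta> s - e < \<beta> r"
      unfolding eventually_at_right_field by blast
    have "AE x in lebesgue. u r x \<le> \<beta> r" if r: "s < r" "r < z" for r
      using AE_bound_if_norm_less[OF conjunct1[OF z(2)[OF r]]] init(2)
    proof eventually_elim
      case (elim x)
      have "\<beta> s = b" by (simp add: \<beta>_def)
      with z(2)[OF r] elim show ?case unfolding abs_less_iff e_def by (simp add: field_simps)
    qed
    with z(1) True show ?thesis by (intro exI[of _ "z - s"]) auto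
  next
    case False
    with right have st: "s < t" by simp
    note rt = rate[OF st right(2) right(3)]
    \<comment> \<open>The strict slack in the slope absorbs the error of the difference
      quotient.\<close>
    define e where "e = c - (k t + g (\<beta> t))"
    have "e > 0" using rt by (simp add: e_def)
    have "u t \<in> L1_Linf" using cont st by (auto simp: L1_Linf_continuous_on_def)
    then obtain R where R: "0 < R" "AE x in lebesgue. \<bar>u t x\<bar> \<le> R"
      by (rule L1_Linf_AE_bounded)
    obtain L0 where L0: "\<And>y z. \<bar>y\<bar> \<le> max R \<bar>\<beta> t\<bar> \<Longrightarrow> \<bar>z\<bar> \<le> max R \<bar>\<beta> t\<bar> \<Longrightarrow> \<bar>g y - g z\<bar> \<le> L0 * \<bar>y - z\<bar>"
      using g_lipschitz[of "max R \<bar>\<beta> t\<bar>"] by blast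
    \<comment> \<open>A positive Lipschitz constant is needed for the step size
      \<open>1 / L\<close>.\<close>
    define L where "L = max 1 L0"
    have L: "\<bar>g y - g z\<bar> \<le> L * \<bar>y - z\<bar>" if "\<bar>y\<bar> \<le> max R \<bar>\<beta> t\<bar>" "\<bar>z\<bar> \<le> max R \<bar>\<beta> t\<bar>" for y z
      using L0[OF that] mult_right_mono[of L0 L "\<bar>y - z\<bar>"] by (simp add: L_def)
    have "L > 0" by (simp add: L_def)
    have "((\<lambda>h. norm_L1_Linf (\<lambda>x. (u (t + h) x - u t x) / h - v t x)) \<longlongrightarrow> 0) (at 0)"
      using deriv[OF st] by (simp add: has_L1_Linf_derivative_def)
    from order_tendstoD(2)[OF this, of "ennreal e"] \<open>e > 0\<close>
    obtain \<delta> where \<delta>: "\<delta> > 0" "\<And>h. h \<noteq> 0 \<Longrightarrow> \<bar>h\<bar> < \<delta>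
        \<Longrightarrow> norm_L1_Linf (\<lambda>x. (u (t + h) x - u t x) / h - v t x) < ennreal e"
      by (auto simp: eventually_at dist_real_def)
    have "AE x in lebesgue. u (t + h) x \<le> \<beta> (t + h)" if h: "0 < h" "h < \<delta>" "h < 1 / L" for h
    proof -
      have quot: "norm_L1_Linf (\<lambda>x. (u (t + h) x - u t x) / h - v t x) < ennreal e"
        using \<delta>(2) h by simp
      show ?thesis
      using AE_bound_if_norm_less[OF quot] rt[THEN conjunct2] R(2) right(3)
    proof eventually_elim
      case (elim x)
      have 1: "(u (t + h) x - u t x) / h < v t x + e" using elim h by (simp add: abs_less_iff)
      have "u (t + h) x - u t x = h * ((u (t + h) x - u t x) / h)" using h by simp
      also have "\<dots> \<le> h * (v t x + e)"
        using 1 h by (intro mult_left_mono) auto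
      also have "\<dots> \<le> h * (k t + g (u t x) + e)"
        using elim h by (intro mult_left_mono) auto
      also have "\<dots> = h * (c + (g (u t x) - g (\<beta> t)))"
        by (simp add: e_def)
      also have "\<dots> \<le> h * (c + L * (\<beta> t - u t x))"
      proof -
        have "\<bar>g (u t x) - g (\<beta> t)\<bar> \<le> L * \<bar>u t x - \<beta> t\<bar>"
          using elim by (intro L) auto
        with elim h show ?thesis by (intro mult_left_mono) auto
      qed
      \<comment> \<open>For \<open>h \<le> 1 / L\<close> the Euler step \<open>y \<mapsto> y + h * g y\<close> is nondecreasing, so it preserves \<open>u \<le> \<beta>\<close>.\<close>
      also have "\<dots> = h * c + (h * L) * (\<beta> t - u t x)"
        by (simp add: algebra_simps)
      also have "\<dots> \<le> h * c + 1 * (\<beta> t - u t x)"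
        using elim h \<open>L > 0\<close> by (intro add_left_mono mult_right_mono) (auto simp: field_simps)
      finally show ?case by (simp add: \<beta>_def algebra_simps)
      qed
    qed
    from this[of "r - t" for r] \<delta>(1) \<open>L > 0\<close> show ?thesis
      by (intro exI[of _ "min \<delta> (1 / L)"]) auto
  qed
qed

section \<open>Convolution with a probability density\<close>

text \<open>The exceptional set of \<open>P\<close> lies in a Borel null set, and the reflection of
  that set is again null.\<close>

lemma AE_lebesgue_reflect:
  assumes "AE z in lebesgue. P (z::real)"
  shows "AE y in lebesgue. P (x - y)"
proof -
  have "AE z in lborel. P z" using assms by (simp add: AE_completion_iff)
  then obtain N where N: "{z. \<not> P z} \<subseteq> N" "N \<in> null_sets lborel"
    by (auto simp: eventually_ae_filter)
  have [measurable]: "N \<in> sets borel" using N(2) by auto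
  have "AE z in lborel. z \<notin> N" by (rule AE_not_in[OF N(2)])
  then have "AE y in lborel. x + (-1) * y \<notin> N"
    by (rule AE_borel_affine[rotated -1]) auto
  then have "AE y in lborel. P (x - y)"
    by eventually_elim (use N(1) in auto)
  then show ?thesis by (rule AE_completion)
qed

lemma integrable_reflect_lebesgue:
  "integrable lebesgue K \<Longrightarrow> integrable lebesgue (\<lambda>y. K (x - y))" for K :: "real \<Rightarrow> real"
  using lebesgue_integrable_real_affine[of K "-1" x] by simp

lemma integral_reflect_lebesgue:
  "(LINT y|lebesgue. K (x - y)) = (LINT y|lebesgue. K y)" for K :: "real \<Rightarrow> real"
  using lebesgue_integral_real_affine[of "-1" K x] by simp

text \<open>An almost everywhere bound on \<open>w\<close> dominates the integrand by a multiple of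
  the reflected kernel. Thus the integral in \<open>convolve\<close> exists at every
  \<open>x\<close>, and is never a default value.\<close>

lemma integrable_convolve_integrand:
  assumes K: "integrable lebesgue K" and w: "w \<in> L1_Linf"
  shows "integrable lebesgue (\<lambda>y. K (x - y) * w y)"
proof -
  obtain R where R: "0 < R" "AE y in lebesgue. \<bar>w y\<bar> \<le> R"
    using w by (rule L1_Linf_AE_bounded)
  have [measurable]: "w \<in> borel_measurable lebesgue" using w by (simp add: L1_Linf_def)
  note K' = integrable_reflect_lebesgue[OF K, of x]
  have [measurable]: "(\<lambda>y. K (x - y)) \<in> borel_measurable lebesgue" using K' by auto
  show ?thesis
  proof (rule Bochner_Integration.integrable_bound)
    show "integrable lebesgue (\<lambda>y. R * K (x - y))" using K' by simp
    show "AE y in lebesgue. norm (K (x - y) * w y) \<le> norm (R * K (x - y))"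
      using R(2) by eventually_elim
        (use R(1) in \<open>auto simp: abs_mult mult.commute intro: mult_right_mono\<close>)
  qed simp
qed

text \<open>The convolution is an average of \<open>w\<close> against a probability density.\<close>

lemma convolve_le:
  assumes K: "integrable lebesgue K" "\<And>x. 0 \<le> K x" "(LINT x|lebesgue. K x) = 1"
    and w: "w \<in> L1_Linf" and le: "AE y in lebesgue. w y \<le> B"
  shows "convolve K w x \<le> B"
proof -
  note K' = integrable_reflect_lebesgue[OF K(1), of x]
  have "convolve K w x \<le> (LINT y|lebesgue. B * K (x - y))"
    unfolding convolve_def
  proof (rule integral_mono_AE)
    show "AE y in lebesgue. K (x - y) * w y \<le> B * K (x - y)"
      using le by eventually_elim (use K(2) in \<open>auto simp: mult.commute intro: mult_right_mono\<close>)
  qed (use integrable_convolve_integrand[OF K(1) w] K' in auto)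
  also have "\<dots> = B" by (simp add: integral_reflect_lebesgue[of K] K(3))
  finally show ?thesis .
qed

text \<open>Split \<open>K\<close> into \<open>min K R\<close> and the excess over \<open>R\<close>.
  The first part sees only the mass of \<open>w\<close>, the second only the bound
  \<open>w \<le> 1\<close>; the result is uniform in \<open>x\<close> even for an unbounded
  kernel.\<close>

lemma convolve_le_truncated:
  assumes K: "integrable lebesgue K" "\<And>x. 0 \<le> K x"
    and w: "w \<in> L1_Linf" "AE y in lebesgue. 0 \<le> w y" "AE y in lebesgue. w y \<le> 1"
    and "0 \<le> R"
  shows "convolve K w x \<le> R * (LINT y|lebesgue. w y) + (LINT y|lebesgue. max 0 (K y - R))"
proof -
  have "integrable lebesgue (\<lambda>y. max 0 (K y - R))"
  proof (rule Bochner_Integration.integrable_bound[OF K(1)])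
    have [measurable]: "K \<in> borel_measurable lebesgue" using K(1) by auto
    show "(\<lambda>y. max 0 (K y - R)) \<in> borel_measurable lebesgue" by simp
    show "AE y in lebesgue. norm (max 0 (K y - R)) \<le> norm (K y)"
      using K(2) \<open>0 \<le> R\<close> by (auto simp: max_def)
  qed
  then have int: "integrable lebesgue (\<lambda>y. max 0 (K (x - y) - R))"
    by (rule integrable_reflect_lebesgue)
  have "convolve K w x \<le> (LINT y|lebesgue. R * w y + max 0 (K (x - y) - R))"
    unfolding convolve_def
  proof (rule integral_mono_AE)
    show "AE y in lebesgue. K (x - y) * w y \<le> R * w y + max 0 (K (x - y) - R)"
      using w(2,3)
    proof eventually_elim
      case (elim y)
      have "K (x - y) * w y \<le> (R + max 0 (K (x - y) - R)) * w y"
        using elim by (intro mult_right_mono) auto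
      also have "\<dots> = R * w y + max 0 (K (x - y) - R) * w y" by (simp add: algebra_simps)
      also have "\<dots> \<le> R * w y + max 0 (K (x - y) - R) * 1"
        using elim by (intro add_left_mono mult_left_mono) auto
      finally show ?case by simp
    qed
  qed (use integrable_convolve_integrand[OF K(1) w(1)] int L1_Linf_integrable[OF w(1)] in auto)
  also have "\<dots> = R * (LINT y|lebesgue. w y) + (LINT y|lebesgue. max 0 (K (x - y) - R))"
    using int L1_Linf_integrable[OF w(1)] by simp
  finally show ?thesis
    by (simp add: integral_reflect_lebesgue[of "\<lambda>y. max 0 (K y - R)"])
qed

text \<open>Dominated convergence with majorant \<open>K\<close>: at each point the integrand
  vanishes once \<open>n\<close> exceeds the value of \<open>K\<close>.\<close>

lemma integral_truncation_tendsto_0: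
  assumes K: "integrable lebesgue K" "\<And>x. 0 \<le> K (x::real)"
  shows "(\<lambda>n. LINT y|lebesgue. max 0 (K y - real n)) \<longlonglongrightarrow> 0"
proof -
  have [measurable]: "K \<in> borel_measurable lebesgue" using K(1) by auto
  have "(\<lambda>n. LINT y|lebesgue. max 0 (K y - real n)) \<longlonglongrightarrow> (LINT y|(lebesgue::real measure). 0)"
  proof (rule integral_dominated_convergence[where w = K])
    show "AE y in lebesgue. (\<lambda>n. max 0 (K y - real n)) \<longlonglongrightarrow> 0"
    proof (rule AE_I2, rule tendsto_eventually)
      fix y
      obtain N :: nat where N: "K y \<le> real N" using real_arch_simple by blast
      show "\<forall>\<^sub>F n in sequentially. max 0 (K y - real n) = 0"
        using eventually_ge_at_top[of N] by eventually_elim (use N in auto)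
    qed
  qed (use K in \<open>auto simp: max_def\<close>)
  then show ?thesis by simp
qed

text \<open>Tonelli's theorem and translation invariance: a kernel of mass one preserves total
  mass.\<close>

lemma integral_convolve:
  assumes K: "integrable lebesgue K" "\<And>x. 0 \<le> K x" "(LINT x|lebesgue. K x) = 1"
    and w: "w \<in> L1_Linf" "AE y in lebesgue. 0 \<le> w y"
  shows "integrable lebesgue (convolve K w)"
    and "(LINT x|lebesgue. convolve K w x) = (LINT x|lebesgue. w x)"
proof -
  have mK: "(\<lambda>x. ennreal (K x)) \<in> borel_measurable lebesgue" using K(1) by auto
  have mw: "(\<lambda>x. ennreal (w x)) \<in> borel_measurable lebesgue" using w(1) by (auto simp: L1_Linf_def)
  \<comment> \<open>\<open>K\<close> and \<open>w\<close> are only Lebesgue measurable. Borel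
    representatives make the double integral jointly measurable.\<close>
  obtain k where k [measurable]: "k \<in> borel_measurable lborel" and kK: "AE x in lborel. ennreal (K x) = k x"
    using completion_ex_borel_measurable[OF mK] by auto
  obtain q where q [measurable]: "q \<in> borel_measurable lborel" and qw: "AE x in lborel. ennreal (w x) = q x"
    using completion_ex_borel_measurable[OF mw] by auto
  have nonneg: "0 \<le> convolve K w x" for x
    unfolding convolve_def
    by (rule integral_nonneg_AE) (use w(2) K(2) in \<open>auto elim!: eventually_mono\<close>)
  have conv: "ennreal (convolve K w x) = (\<integral>\<^sup>+y. k (x - y) * q y \<partial>lborel)" for x
  proof -
    have "ennreal (convolve K w x) = (\<integral>\<^sup>+y. ennreal (K (x - y) * w y) \<partial>lebesgue)"
      unfolding convolve_def using integrable_convolve_integrand[OF K(1) w(1)]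
      by (intro nn_integral_eq_integral[symmetric])
        (use w(2) K(2) in \<open>auto elim!: eventually_mono\<close>)
    also have "\<dots> = (\<integral>\<^sup>+y. k (x - y) * q y \<partial>lebesgue)"
      using AE_lebesgue_reflect[OF AE_completion[OF kK], of x] AE_completion[OF qw] w(2)
      by (intro nn_integral_cong_AE, eventually_elim) (use K(2) in \<open>auto simp: ennreal_mult\<close>)
    finally show ?thesis by (simp add: nn_integral_completion)
  qed
  have "(\<integral>\<^sup>+x. ennreal (convolve K w x) \<partial>lebesgue) = (\<integral>\<^sup>+x. \<integral>\<^sup>+y. k (x - y) * q y \<partial>lborel \<partial>lborel)"
    by (simp add: conv nn_integral_completion)
  also have "\<dots> = (\<integral>\<^sup>+y. \<integral>\<^sup>+x. k (x - y) * q y \<partial>lborel \<partial>lborel)"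
    by (rule lborel_pair.Fubini'[symmetric]) measurable
  also have "\<dots> = (\<integral>\<^sup>+y. (\<integral>\<^sup>+x. k x \<partial>lborel) * q y \<partial>lborel)"
  proof (rule nn_integral_cong)
    fix y
    have "(\<integral>\<^sup>+x. k (x - y) * q y \<partial>lborel) = (\<integral>\<^sup>+x. k (x - y) \<partial>lborel) * q y"
      by (rule nn_integral_multc) measurable
    also have "(\<integral>\<^sup>+x. k (x - y) \<partial>lborel) = (\<integral>\<^sup>+x. k x \<partial>lborel)"
      using nn_integral_real_affine[of k 1 "- y"] by simp
    finally show "(\<integral>\<^sup>+x. k (x - y) * q y \<partial>lborel) = (\<integral>\<^sup>+x. k x \<partial>lborel) * q y" .
  qed
  also have "(\<integral>\<^sup>+x. k x \<partial>lborel) = (\<integral>\<^sup>+x. ennreal (K x) \<partial>lebesgue)"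
    unfolding nn_integral_completion
    by (intro nn_integral_cong_AE) (use kK in \<open>auto elim: eventually_mono\<close>)
  also have "\<dots> = 1"
    using K by (subst nn_integral_eq_integral) auto
  also have "(\<integral>\<^sup>+y. 1 * q y \<partial>lborel) = (\<integral>\<^sup>+y. ennreal (w y) \<partial>lebesgue)"
    unfolding nn_integral_completion
    by (intro nn_integral_cong_AE) (use qw in \<open>auto elim: eventually_mono\<close>)
  also have "\<dots> = ennreal (LINT y|lebesgue. w y)"
    using w L1_Linf_integrable by (intro nn_integral_eq_integral) auto
  finally have nn: "(\<integral>\<^sup>+x. ennreal (convolve K w x) \<partial>lebesgue) = ennreal (LINT y|lebesgue. w y)" .
  \<comment> \<open>The identity \<open>conv\<close> holds at every \<open>x\<close>, so the
    convolution is itself a Borel function.\<close>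
  have "convolve K w = (\<lambda>x. enn2real (\<integral>\<^sup>+y. k (x - y) * q y \<partial>lborel))"
    using nonneg by (simp add: conv[symmetric] fun_eq_iff)
  also have "\<dots> \<in> borel_measurable lborel" by measurable
  finally have meas: "convolve K w \<in> borel_measurable lebesgue"
    by (rule measurable_completion)
  show "integrable lebesgue (convolve K w)"
    by (rule integrableI_nonneg[OF meas]) (use nonneg nn in auto)
  have "0 \<le> (LINT y|lebesgue. w y)" using w(2) by (rule integral_nonneg_AE)
  then show "(LINT x|lebesgue. convolve K w x) = (LINT x|lebesgue. w x)"
    by (subst integral_eq_nn_integral[OF meas]) (use nonneg nn in auto)
qed

section \<open>Solutions of the nonlocal equation\<close>

text \<open>The initial datum is left open, because barriers are started at several times. The
  assumptions are stable under replacing \<open>u\<close> by \<open>- u\<close> and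
  \<open>f y\<close> by \<open>- f (- y)\<close>.\<close>

locale nonlocal_solution =
  fixes d :: real and f K :: "real \<Rightarrow> real" and u v :: "real \<Rightarrow> real \<Rightarrow> real"
  assumes d_pos: "0 < d"
    and f_lipschitz: "\<And>R. \<exists>L. \<forall>y z. \<bar>y\<bar> \<le> R \<and> \<bar>z\<bar> \<le> R \<longrightarrow> \<bar>f y - f z\<bar> \<le> L * \<bar>y - z\<bar>"
    and K_integrable: "integrable lebesgue K"
    and K_nonneg: "\<And>x. 0 \<le> K x"
    and K_mass: "(LINT x|lebesgue. K x) = 1"
    and u_cont: "L1_Linf_continuous_on {0..} u"
    and v_cont: "L1_Linf_continuous_on {0<..} v"
    and u_deriv: "\<And>t. 0 < t \<Longrightarrow> has_L1_Linf_derivative u (v t) t"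
    and v_eq: "\<And>t. 0 < t \<Longrightarrow> AE x in lebesgue. v t x = d * (- u t x + convolve K (u t) x) + f (u t x)"
begin

lemma u_L1_Linf: "0 \<le> t \<Longrightarrow> u t \<in> L1_Linf"
  using u_cont by (auto simp: L1_Linf_continuous_on_def)

text \<open>The local loss \<open>- d * u\<close> is merged with the reaction, leaving the
  convolution as the only nonlocal term.\<close>

lemma reaction_lipschitz:
  "\<exists>L. \<forall>y z. \<bar>y\<bar> \<le> R \<and> \<bar>z\<bar> \<le> R \<longrightarrow> \<bar>(f y - d * y) - (f z - d * z)\<bar> \<le> L * \<bar>y - z\<bar>"
proof -
  obtain L where L: "\<And>y z. \<bar>y\<bar> \<le> R \<Longrightarrow> \<bar>z\<bar> \<le> R \<Longrightarrow> \<bar>f y - f z\<bar> \<le> L * \<bar>y - z\<bar>"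
    using f_lipschitz[of R] by blast
  have "\<bar>(f y - d * y) - (f z - d * z)\<bar> \<le> (L + d) * \<bar>y - z\<bar>" if "\<bar>y\<bar> \<le> R" "\<bar>z\<bar> \<le> R" for y z
  proof -
    have "(f y - d * y) - (f z - d * z) = (f y - f z) - d * (y - z)" by (simp add: algebra_simps)
    also have "\<bar>\<dots>\<bar> \<le> \<bar>f y - f z\<bar> + \<bar>d * (y - z)\<bar>" by (rule abs_triangle_ineq4)
    also have "\<dots> \<le> L * \<bar>y - z\<bar> + d * \<bar>y - z\<bar>"
      using L[OF that] d_pos by (simp add: abs_mult)
    finally show ?thesis by (simp add: algebra_simps)
  qed
  then show ?thesis by blast
qed

text \<open>The convolution enters only through its upper bound \<open>k\<close>, which is later
  either the barrier itself or a small constant coming from the mass.\<close>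

lemma barrier_convolution_bound:
  assumes "0 \<le> s" "s \<le> T" "b' < b" "AE x in lebesgue. u s x \<le> b'"
    and conv: "\<And>t x. \<lbrakk>s < t; t < T; AE x in lebesgue. u t x \<le> b + c * (t - s)\<rbrakk>
      \<Longrightarrow> convolve K (u t) x \<le> k t"
    and rate: "\<And>t. \<lbrakk>s < t; t < T\<rbrakk>
      \<Longrightarrow> d * (k t - (b + c * (t - s))) + f (b + c * (t - s)) < c"
  shows "AE x in lebesgue. u T x \<le> b + c * (T - s)"
proof (rule affine_barrier[where g = "\<lambda>y. f y - d * y" and k = "\<lambda>t. d * k t" and v = v])
  show "L1_Linf_continuous_on {s..} u"
    using \<open>0 \<le> s\<close> by (intro L1_Linf_continuous_on_subset[OF u_cont]) auto
  show "has_L1_Linf_derivative u (v t) t" if "s < t" for t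
    using that \<open>0 \<le> s\<close> by (intro u_deriv) auto
  fix t assume t: "s < t" "t < T" "AE x in lebesgue. u t x \<le> b + c * (t - s)"
  have "AE x in lebesgue. v t x = d * (- u t x + convolve K (u t) x) + f (u t x)"
    using t \<open>0 \<le> s\<close> by (intro v_eq) auto
  then have "AE x in lebesgue. v t x \<le> d * k t + (f (u t x) - d * u t x)"
  proof eventually_elim
    case (elim x)
    have "d * convolve K (u t) x \<le> d * k t"
      using conv[OF t] d_pos by (intro mult_left_mono) auto
    with elim show ?case by (simp add: algebra_simps)
  qed
  moreover have "d * k t + (f (b + c * (t - s)) - d * (b + c * (t - s))) < c"
    using rate[OF t(1,2)] by (simp add: algebra_simps)
  ultimately show "d * k t + (f (b + c * (t - s)) - d * (b + c * (t - s))) < c \<and>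
      (AE x in lebesgue. v t x \<le> d * k t + (f (u t x) - d * u t x))"
    by blast
qed (use assms reaction_lipschitz in auto)

text \<open>Bounding the convolution by the barrier makes the dispersal term vanish, so only the
  reaction competes with the slope.\<close>

lemma upper_barrier:
  assumes "0 \<le> s" "s \<le> T" "b' < b" "AE x in lebesgue. u s x \<le> b'"
    and rate: "\<And>t. \<lbrakk>s < t; t < T\<rbrakk> \<Longrightarrow> f (b + c * (t - s)) < c"
  shows "AE x in lebesgue. u T x \<le> b + c * (T - s)"
proof (rule barrier_convolution_bound[where k = "\<lambda>t. b + c * (t - s)"])
  show "convolve K (u t) x \<le> b + c * (t - s)"
    if "s < t" "t < T" "AE x in lebesgue. u t x \<le> b + c * (t - s)" for t x
    using that \<open>0 \<le> s\<close> by (intro convolve_le K_integrable K_nonneg K_mass u_L1_Linf) auto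
qed (use assms in auto)

text \<open>\<open>B\<close> may be a zero of \<open>f\<close>, where the strict inequality fails.
  The constants \<open>B + e\<close> are strict barriers, and \<open>e\<close> then tends to
  0.\<close>

lemma upper_invariant:
  assumes "0 < e\<^sub>0" and neg: "\<And>e. \<lbrakk>0 < e; e < e\<^sub>0\<rbrakk> \<Longrightarrow> f (B + e) < 0"
    and "AE x in lebesgue. u 0 x \<le> B" "0 \<le> t"
  shows "AE x in lebesgue. u t x \<le> B"
proof (rule AE_le_if_le_add[OF \<open>0 < e\<^sub>0\<close>])
  fix e assume "0 < e" "e < e\<^sub>0"
  with upper_barrier[of 0 t B "B + e" 0] neg assms show "AE x in lebesgue. u t x \<le> B + e" by auto
qed

lemma nonlocal_solution_uminus:
  "nonlocal_solution d (\<lambda>y. - f (- y)) K (\<lambda>t x. - u t x) (\<lambda>t x. - v t x)"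
proof
  fix R
  obtain L where L: "\<And>y z. \<bar>y\<bar> \<le> R \<Longrightarrow> \<bar>z\<bar> \<le> R \<Longrightarrow> \<bar>f y - f z\<bar> \<le> L * \<bar>y - z\<bar>"
    using f_lipschitz[of R] by blast
  have "\<bar>- f (- y) - - f (- z)\<bar> \<le> L * \<bar>y - z\<bar>" if "\<bar>y\<bar> \<le> R" "\<bar>z\<bar> \<le> R" for y z
    using L[of "- y" "- z"] that by (simp add: abs_minus_commute)
  then show "\<exists>L. \<forall>y z. \<bar>y\<bar> \<le> R \<and> \<bar>z\<bar> \<le> R \<longrightarrow> \<bar>- f (- y) - - f (- z)\<bar> \<le> L * \<bar>y - z\<bar>"
    by blast
next
  fix t :: real assume "0 < t"
  from v_eq[OF this]
  show "AE x in lebesgue. - v t x = d * (- (- u t x) + convolve K (\<lambda>x. - u t x) x) + - f (- (- u t x))"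
    by eventually_elim (simp add: convolve_def algebra_simps)
qed (use d_pos K_integrable K_nonneg K_mass u_cont v_cont u_deriv in
    \<open>auto intro: L1_Linf_continuous_on_uminus has_L1_Linf_derivative_uminus\<close>)

lemma lower_invariant:
  assumes "0 < e\<^sub>0" and pos: "\<And>e. \<lbrakk>0 < e; e < e\<^sub>0\<rbrakk> \<Longrightarrow> f (B - e) > 0"
    and "AE x in lebesgue. B \<le> u 0 x" "0 \<le> t"
  shows "AE x in lebesgue. B \<le> u t x"
proof -
  interpret neg: nonlocal_solution d "\<lambda>y. - f (- y)" K "\<lambda>t x. - u t x" "\<lambda>t x. - v t x"
    by (rule nonlocal_solution_uminus)
  from neg.upper_invariant[of e\<^sub>0 "- B" t] assms show ?thesis
    by (simp add: add.commute)
qed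

text \<open>Dispersal preserves mass, so the mass grows at relative rate at most
  \<open>\<kappa>\<close>; Gronwall's argument concludes.\<close>

lemma mass_growth:
  assumes range: "\<And>t. 0 \<le> t \<Longrightarrow> AE x in lebesgue. 0 \<le> u t x \<and> u t x \<le> 1"
    and f_le: "\<And>y. \<lbrakk>0 \<le> y; y \<le> 1\<rbrakk> \<Longrightarrow> f y \<le> \<kappa> * y" and "0 \<le> T"
  shows "(LINT x|lebesgue. u T x) \<le> exp (\<kappa> * T) * (LINT x|lebesgue. u 0 x)"
proof (cases "T = 0")
  case False
  with \<open>0 \<le> T\<close> have "0 < T" by simp
  define I where "I t = (LINT x|lebesgue. u t x)" for t
  have int_u: "integrable lebesgue (u t)" if "0 \<le> t" for t
    using u_L1_Linf[OF that] by (rule L1_Linf_integrable)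
  have int_v: "integrable lebesgue (v t)" if "0 < t" for t
    using that v_cont by (intro L1_Linf_integrable) (auto simp: L1_Linf_continuous_on_def)
  have I_deriv: "(I has_real_derivative (LINT x|lebesgue. v t x)) (at t)" if "0 < t" for t
    unfolding I_def
  proof (rule has_real_derivative_integral[OF u_deriv[OF that] int_v[OF that]])
    show "\<forall>\<^sub>F s in nhds t. integrable lebesgue (u s)"
      using eventually_nhds_in_open[of "{0<..}" t] that
      by (auto elim!: eventually_mono intro: int_u)
  qed
  have v_le: "(LINT x|lebesgue. v t x) \<le> \<kappa> * I t" if "0 < t" for t
  proof -
    have nonneg: "AE x in lebesgue. 0 \<le> u t x" using range[of t] that by auto
    note conv = integral_convolve[OF K_integrable K_nonneg K_mass u_L1_Linf[OF less_imp_le[OF that]] nonneg]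
    note int = int_u[OF less_imp_le[OF that]]
    have "(LINT x|lebesgue. v t x) \<le> (LINT x|lebesgue. d * (- u t x + convolve K (u t) x) + \<kappa> * u t x)"
    proof (rule integral_mono_AE)
      show "AE x in lebesgue. v t x \<le> d * (- u t x + convolve K (u t) x) + \<kappa> * u t x"
        using v_eq[OF that] range[OF less_imp_le[OF that]]
        by eventually_elim (use f_le in auto)
    qed (use int_v[OF that] int conv(1) in auto)
    \<comment> \<open>The integrals of \<open>u t\<close> and of its convolution cancel.\<close>
    also have "\<dots> = \<kappa> * I t"
      using int conv by (simp add: I_def)
    finally show ?thesis .
  qed
  have cont: "continuous_on {0..T} (\<lambda>t. exp (- \<kappa> * t) * I t)"
    unfolding I_def
    by (intro continuous_intros continuous_on_integral L1_Linf_continuous_on_subset[OF u_cont]) auto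
  \<comment> \<open>The derivative exists only for positive times; continuity covers time 0.\<close>
  have "exp (- \<kappa> * T) * I T \<le> exp (- \<kappa> * 0) * I 0"
  proof (rule DERIV_nonpos_imp_decreasing_open[OF \<open>0 \<le> T\<close> _ cont])
    fix t assume t: "0 < t" "t < T"
    have "((\<lambda>t. exp (- \<kappa> * t) * I t) has_real_derivative
        exp (- \<kappa> * t) * ((LINT x|lebesgue. v t x) - \<kappa> * I t)) (at t)"
      by (rule derivative_eq_intros I_deriv t refl | simp add: algebra_simps)+
    moreover have "exp (- \<kappa> * t) * ((LINT x|lebesgue. v t x) - \<kappa> * I t) \<le> 0"
      using v_le[OF t(1)] by (intro mult_nonneg_nonpos) auto
    ultimately show "\<exists>y. ((\<lambda>t. exp (- \<kappa> * t) * I t) has_real_derivative y) (at t) \<and> y \<le> 0"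
      by blast
  qed
  then have "exp (\<kappa> * T) * (exp (- \<kappa> * T) * I T) \<le> exp (\<kappa> * T) * I 0"
    by (intro mult_left_mono) auto
  then show ?thesis
    by (simp add: I_def exp_minus field_simps)
qed simp

text \<open>Away from 0, \<open>f\<close> is bounded above by a negative constant on the range in
  question, so a decreasing line reaches any positive level in finite time. A constant barrier then
  keeps the solution low.\<close>

lemma extinction_below_threshold:
  assumes f_cont: "continuous_on {0<..b} f" and neg: "\<And>y. \<lbrakk>0 < y; y \<le> b\<rbrakk> \<Longrightarrow> f y < 0"
    and "0 \<le> T" "0 < b" "b' < b" "AE x in lebesgue. u T x \<le> b'" and "0 < \<epsilon>"
  shows "\<exists>T'\<ge>T. \<forall>t\<ge>T'. AE x in lebesgue. u t x \<le> \<epsilon>"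
proof -
  define e where "e = min \<epsilon> b"
  have e: "0 < e" "e \<le> \<epsilon>" "e \<le> b" using assms by (auto simp: e_def)
  have "continuous_on {e / 2..b} f"
    using f_cont by (rule continuous_on_subset) (use e in auto)
  then obtain z where z: "z \<in> {e / 2..b}" "\<And>y. y \<in> {e / 2..b} \<Longrightarrow> f y \<le> f z"
    using continuous_attains_sup[of "{e / 2..b}" f] e by auto
  have "f z < 0" using z e by (intro neg) auto
  \<comment> \<open>Half of the negative maximum leaves the slope strictly above \<open>f\<close>;
    \<open>T'\<close> below is the time at which the line from \<open>b\<close> reaches
    \<open>e / 2\<close>.\<close>
  define c where "c = f z / 2"
  have c: "c < 0" using \<open>f z < 0\<close> by (simp add: c_def)
  define T' where "T' = T + (b - e / 2) / (- c)"
  have T': "T \<le> T'" using c e by (simp add: T'_def divide_nonneg_neg)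
  have end_val: "b + c * (T' - T) = e / 2" using c by (simp add: T'_def field_simps)
  have "AE x in lebesgue. u T' x \<le> b + c * (T' - T)"
  proof (rule upper_barrier)
    fix t assume t: "T < t" "t < T'"
    have "c * (T' - T) \<le> c * (t - T)" "c * (t - T) \<le> 0"
      using t c by (auto intro: mult_left_mono_neg mult_nonpos_nonneg)
    with end_val have "b + c * (t - T) \<in> {e / 2..b}" by auto
    from z(2)[OF this] show "f (b + c * (t - T)) < c" using \<open>f z < 0\<close> by (simp add: c_def)
  qed (use assms T' in auto)
  then have T'_le: "AE x in lebesgue. u T' x \<le> e / 2" by (simp only: end_val)
  have "AE x in lebesgue. u t x \<le> \<epsilon>" if "T' \<le> t" for t
  proof -
    \<comment> \<open>Descending to \<open>e / 2\<close> provides the strict initial gap for the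
      constant barrier \<open>e\<close>.\<close>
    have "AE x in lebesgue. u t x \<le> e + 0 * (t - T')"
      by (rule upper_barrier[OF _ that _ T'_le]) (use e \<open>0 \<le> T\<close> T' neg in auto)
    then show ?thesis by eventually_elim (use e in auto)
  qed
  with T' show ?thesis by blast
qed

end

text \<open>The orders 0 and 1 of smoothness make the derivative continuous, hence bounded on
  compact intervals; the mean value inequality does the rest.\<close>

lemma smooth_locally_lipschitz:
  assumes "smooth f"
  shows "\<exists>L. \<forall>y z. \<bar>y\<bar> \<le> R \<and> \<bar>z\<bar> \<le> R \<longrightarrow> \<bar>f y - f z\<bar> \<le> L * \<bar>y - z\<bar>"
proof -
  have "f differentiable_on UNIV" "deriv f differentiable_on UNIV"
    using assms[unfolded smooth_def, rule_format, of 0] assms[unfolded smooth_def, rule_format, of 1]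
    by simp_all
  then have f': "(f has_real_derivative deriv f y) (at y)" and cont: "continuous_on UNIV (deriv f)" for y
    by (auto simp: differentiable_on_def DERIV_deriv_iff_real_differentiable
        intro: differentiable_imp_continuous_on)
  have "compact (deriv f ` {-R..R})"
    using cont by (intro compact_continuous_image) (auto intro: continuous_on_subset)
  then have "bounded (deriv f ` {-R..R})" by (rule compact_imp_bounded)
  then obtain L where L: "\<And>y. y \<in> {-R..R} \<Longrightarrow> norm (deriv f y) \<le> L"
    by (meson bounded_iff imageI)
  have "\<bar>f y - f z\<bar> \<le> L * \<bar>y - z\<bar>" if "\<bar>y\<bar> \<le> R" "\<bar>z\<bar> \<le> R" for y z
  proof -
    have "norm (f y - f z) \<le> L * norm (y - z)"
      by (rule field_differentiable_bound[where S = "{-R..R}" and f' = "deriv f"])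
        (use that L f' in \<open>auto intro: has_field_derivative_at_within\<close>)
    then show ?thesis by simp
  qed
  then show ?thesis by blast
qed

section \<open>Extinction\<close>

text \<open>Solutions are determined up to null sets in space, so uniform convergence means
  convergence in essential supremum. The threshold \<open>l\<^sub>0\<close> is chosen before
  \<open>u\<close> and serves every function satisfying \<open>cauchy_solution\<close>.\<close>

theorem proposition2p1:
  fixes f K :: "real \<Rightarrow> real" and a \<kappa> :: real
  assumes f_smooth: "smooth f"
    and a: "0 < a" "a < 1"
    and f_zeros: "f 0 = 0" "f a = 0" "f 1 = 0"
    and f_neg: "\<forall>u\<in>{0<..<a}. f u < 0"
    and f_pos: "\<forall>u\<in>{a<..<1}. f u > 0"
    and f_deriv: "deriv f 0 < 0" "deriv f 1 < 0" "deriv f a > 0"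
    and f_integral: "integral {0..1} f > 0"
    and K_integrable: "integrable lebesgue K"
    and K_deriv: "\<exists>K'. weak_derivative K K' \<and> integrable lebesgue K'"
    and K_mass: "(LINT x|lebesgue. K x) = 1"
    and K_nonneg: "\<forall>x. 0 \<le> K x"
    and K_even: "\<forall>x. K x = K (- x)"
    and K_moment: "integrable lebesgue (\<lambda>x. K x * \<bar>x\<bar>)"
    and \<kappa>: "\<kappa> = (SUP u\<in>{a<..<1}. f u / u)"
  shows "\<kappa> > 0 \<and>
    (\<forall>d>\<kappa>. \<exists>l\<^sub>0>0. \<forall>l\<in>{0<..<l\<^sub>0}. \<forall>u.
      cauchy_solution d K f (indicator {-l..l}) u \<longrightarrow>
      (\<forall>\<epsilon>>0. \<forall>\<^sub>F t in at_top. AE x in lebesgue. \<bar>u t x\<bar> < \<epsilon>))"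
proof -

  \<comment> \<open>Linear bound and signs of the reaction\<close>
  have f': "(f has_real_derivative deriv f y) (at y)" for y
    using f_smooth[unfolded smooth_def, rule_format, of 0]
    by (simp add: differentiable_on_def DERIV_deriv_iff_real_differentiable)
  then have f_cont: "continuous_on S f" for S
    by (meson DERIV_isCont continuous_at_imp_continuous_on)
  \<comment> \<open>Boundedness gives the supremum its intended value; the compact interval from
    \<open>a\<close> to 1 stays away from the pole at 0.\<close>
  have bdd: "bdd_above ((\<lambda>y. f y / y) ` {a<..<1})"
  proof -
    have "compact ((\<lambda>y. f y / y) ` {a..1})"
      using a by (intro compact_continuous_image continuous_intros f_cont) auto
    then have "bdd_above ((\<lambda>y. f y / y) ` {a..1})"
      by (intro bounded_imp_bdd_above compact_imp_bounded)
    then show ?thesis by (rule bdd_above_mono) auto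
  qed
  have le_\<kappa>: "f y / y \<le> \<kappa>" if "a < y" "y < 1" for y
    unfolding \<kappa> using bdd that by (intro cSUP_upper) auto
  have "0 < f ((a + 1) / 2) / ((a + 1) / 2)"
    using a f_pos by (intro divide_pos_pos) auto
  also have "\<dots> \<le> \<kappa>" using a by (intro le_\<kappa>) auto
  finally have "0 < \<kappa>" .
  \<comment> \<open>The signs of the derivative at 1 and at 0 make constants just above 1 and just
    below 0 strict barriers.\<close>
  obtain e\<^sub>1 where e1: "0 < e\<^sub>1" "\<And>e. \<lbrakk>0 < e; e < e\<^sub>1\<rbrakk> \<Longrightarrow> f (1 + e) < 0"
    using DERIV_neg_dec_right[OF f' f_deriv(2)] f_zeros by auto
  obtain e\<^sub>2 where e2: "0 < e\<^sub>2" "\<And>e. \<lbrakk>0 < e; e < e\<^sub>2\<rbrakk> \<Longrightarrow> 0 < f (0 - e)"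
    using DERIV_neg_dec_left[OF f' f_deriv(1)] f_zeros by auto
  \<comment> \<open>The bound is carried slightly beyond 1, where \<open>f\<close> is negative,
    because the descending barrier must start above 1.\<close>
  have f_le: "f y \<le> \<kappa> * y" if "0 \<le> y" "y < 1 + e\<^sub>1" for y
  proof (cases "a < y \<and> y < 1")
    case True
    with le_\<kappa>[of y] a show ?thesis by (simp add: field_simps)
  next
    case False
    then have "y = 0 \<or> y \<in> {0<..<a} \<or> y = a \<or> y = 1 \<or> 0 < y - 1 \<and> y - 1 < e\<^sub>1"
      using that by auto
    then have "f y \<le> 0"
      using f_zeros f_neg e1(2)[of "y - 1"] by (auto simp: less_imp_le)
    also have "0 \<le> \<kappa> * y" using \<open>0 < \<kappa>\<close> that by simp
    finally show ?thesis .
  qed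
  have "\<exists>l\<^sub>0>0. \<forall>l\<in>{0<..<l\<^sub>0}. \<forall>u. cauchy_solution d K f (indicator {-l..l}) u \<longrightarrow>
      (\<forall>\<epsilon>>0. \<forall>\<^sub>F t in at_top. AE x in lebesgue. \<bar>u t x\<bar> < \<epsilon>)" if "\<kappa> < d" for d
  proof -

    \<comment> \<open>Choice of the constants\<close>
    have "0 < d" using \<open>0 < \<kappa>\<close> that by simp
    \<comment> \<open>At heights \<open>y \<ge> a / 2\<close> the net loss
      \<open>(d - \<kappa>) * y\<close> is at least twice \<open>d * \<delta>\<close>. The resulting
      rate is at most \<open>2 * c\<close>, strictly below \<open>c\<close>.\<close>
    define \<delta> where "\<delta> = (d - \<kappa>) * a / (4 * d)"
    have \<delta>: "0 < \<delta>" "d * \<delta> = (d - \<kappa>) * a / 4"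
      using \<open>0 < d\<close> that a by (simp_all add: \<delta>_def)
    define c where "c = - ((d - \<kappa>) * a / 8)"
    have c: "c < 0" using that a by (simp add: c_def)
    define b where "b = 1 + e\<^sub>1 / 2"
    have b: "1 < b" "b < 1 + e\<^sub>1" using e1(1) by (simp_all add: b_def)
    \<comment> \<open>The line of slope \<open>c\<close> from \<open>b\<close> reaches
      \<open>a / 2\<close> at time \<open>T\<close>, which does not depend on
      \<open>l\<close>.\<close>
    define T where "T = (b - a / 2) / (- c)"
    have T: "0 \<le> T" "b + c * T = a / 2"
      using c b a by (simp_all add: T_def divide_nonneg_neg)
    have "\<forall>\<^sub>F n in sequentially. (LINT y|lebesgue. max 0 (K y - real n)) < \<delta> / 2"
      using integral_truncation_tendsto_0[OF K_integrable] K_nonneg \<delta>(1)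
      by (intro order_tendstoD(2)) auto
    then obtain n where n: "(LINT y|lebesgue. max 0 (K y - real n)) < \<delta> / 2"
      using eventually_happens by fastforce
    \<comment> \<open>This makes \<open>n\<close> times the mass bound at time \<open>T\<close> less
      than \<open>\<delta> / 2\<close>; using \<open>n + 1\<close> avoids division by zero.\<close>
    define l\<^sub>0 where "l\<^sub>0 = \<delta> / (4 * (real n + 1) * exp (\<kappa> * T))"
    have "0 < l\<^sub>0" using \<delta>(1) by (simp add: l\<^sub>0_def)
    have extinct: "\<forall>\<^sub>F t in at_top. AE x in lebesgue. \<bar>u t x\<bar> < \<epsilon>"
      if l: "0 < l" "l < l\<^sub>0" and sol: "cauchy_solution d K f (indicator {-l..l}) u" and "0 < \<epsilon>"
      for l u \<epsilon>
    proof -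

      \<comment> \<open>A priori bounds from the small initial mass\<close>
      obtain v where "nonlocal_solution d f K u v"
        using sol \<open>0 < d\<close> K_integrable K_mass K_nonneg smooth_locally_lipschitz[OF f_smooth]
        unfolding cauchy_solution_def nonlocal_solution_def by blast
      then interpret nonlocal_solution d f K u v .
      have init: "AE x in lebesgue. u 0 x = indicator {-l..l} x"
        using sol by (simp add: cauchy_solution_def)
      have "AE x in lebesgue. u 0 x \<le> 1" "AE x in lebesgue. 0 \<le> u 0 x"
        using init by (auto elim!: eventually_mono simp: indicator_def)
      then have le1: "AE x in lebesgue. u t x \<le> 1" and ge0: "AE x in lebesgue. 0 \<le> u t x"
        if "0 \<le> t" for t
        using upper_invariant[OF e1] lower_invariant[OF e2] that by auto
      have mass0: "(LINT x|lebesgue. u 0 x) = 2 * l"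
      proof -
        have "(LINT x|lebesgue. u 0 x) = (LINT x|lebesgue. indicator {-l..l} x)"
          using init u_L1_Linf[of 0] by (intro integral_cong_AE) (auto simp: L1_Linf_def intro!: measurable_completion)
        then show ?thesis using l by simp
      qed
      have mass: "(LINT x|lebesgue. u t x) \<le> exp (\<kappa> * T) * (2 * l)" if "0 \<le> t" "t \<le> T" for t
      proof -
        have "(LINT x|lebesgue. u t x) \<le> exp (\<kappa> * t) * (LINT x|lebesgue. u 0 x)"
        proof (rule mass_growth[OF _ _ that(1)])
          show "AE x in lebesgue. 0 \<le> u s x \<and> u s x \<le> 1" if "0 \<le> s" for s
            using ge0[OF that] le1[OF that] by (rule AE_conjI)
          show "f y \<le> \<kappa> * y" if "0 \<le> y" "y \<le> 1" for y
            using that e1(1) by (intro f_le) auto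
        qed
        also have "\<dots> \<le> exp (\<kappa> * T) * (2 * l)"
          unfolding mass0 using that \<open>0 < \<kappa>\<close> l by (intro mult_right_mono) auto
        finally show ?thesis .
      qed
      have conv: "convolve K (u t) x \<le> \<delta>" if "0 \<le> t" "t \<le> T" for t x
      proof -
        have "convolve K (u t) x \<le> real n * (LINT y|lebesgue. u t y) + (LINT y|lebesgue. max 0 (K y - real n))"
          by (rule convolve_le_truncated[OF K_integrable _ u_L1_Linf ge0 le1]) (use that K_nonneg in auto)
        also have "\<dots> \<le> (real n + 1) * (exp (\<kappa> * T) * (2 * l)) + \<delta> / 2"
        proof (intro add_mono mult_mono mass that)
          show "0 \<le> (LINT y|lebesgue. u t y)" using ge0[OF that(1)] by (rule integral_nonneg_AE)
        qed (use n in auto)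
        also have "\<dots> = l * (4 * (real n + 1) * exp (\<kappa> * T)) / 2 + \<delta> / 2" by simp
        also have "l * (4 * (real n + 1) * exp (\<kappa> * T)) \<le> \<delta>"
          using l(2) by (simp add: l\<^sub>0_def pos_less_divide_eq less_imp_le)
        finally show ?thesis by simp
      qed

      \<comment> \<open>Descent below the threshold and extinction\<close>
      have "AE x in lebesgue. u T x \<le> b + c * (T - 0)"
      \<comment> \<open>Here the mass controls the convolution by \<open>\<delta>\<close>, so the
        barrier can descend through heights where \<open>f\<close> is positive.\<close>
      proof (rule barrier_convolution_bound[where k = "\<lambda>_. \<delta>"])
        show "AE x in lebesgue. u 0 x \<le> 1" by (rule le1) simp
        show "convolve K (u t) x \<le> \<delta>" if "0 < t" "t < T" for t x
          using that by (intro conv) auto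
        fix t assume t: "0 < t" "t < T"
        define y where "y = b + c * (t - 0)"
        have "c * T \<le> c * t" "c * t \<le> 0"
          using t c by (auto intro: mult_left_mono_neg mult_nonpos_nonneg)
        then have y: "a / 2 \<le> y" "y < 1 + e\<^sub>1"
          using T(2) b by (auto simp: y_def)
        have "d * (\<delta> - y) + f y \<le> d * \<delta> - (d - \<kappa>) * y"
          using f_le[of y] y a by (simp add: algebra_simps)
        also have "\<dots> \<le> d * \<delta> - (d - \<kappa>) * (a / 2)"
          using y \<open>\<kappa> < d\<close> by (intro diff_left_mono mult_left_mono) auto
        also have "\<dots> < c"
          using c unfolding \<delta>(2) c_def times_divide_eq_right by linarith
        finally show "d * (\<delta> - (b + c * (t - 0))) + f (b + c * (t - 0)) < c"
          by (simp add: y_def)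
      qed (use T(1) b(1) in auto)
      then have "AE x in lebesgue. u T x \<le> a / 2" by (simp add: T(2))
      then have "\<exists>T'\<ge>T. \<forall>t\<ge>T'. AE x in lebesgue. u t x \<le> \<epsilon> / 2"
        \<comment> \<open>The level \<open>3 * a / 4\<close> lies strictly above
          \<open>a / 2\<close> and strictly below \<open>a\<close>, so \<open>f\<close> is negative
          up to it.\<close>
        by (rule extinction_below_threshold[where b = "3 * a / 4", rotated -2])
          (use f_cont f_neg a(1) T(1) \<open>0 < \<epsilon>\<close> in auto)
      then obtain T' where T': "T \<le> T'" "\<And>t. T' \<le> t \<Longrightarrow> AE x in lebesgue. u t x \<le> \<epsilon> / 2"
        by blast
      show ?thesis
        using eventually_ge_at_top[of T']
      proof eventually_elim
        case (elim t)
        have "0 \<le> t" using elim T(1) T'(1) by simp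
        from T'(2)[OF elim] ge0[OF this] show ?case
          by eventually_elim (use \<open>0 < \<epsilon>\<close> in auto)
      qed
    qed
    show ?thesis
    proof (intro exI[of _ l\<^sub>0] conjI ballI allI impI)
      fix l u and \<epsilon> :: real
      assume "l \<in> {0<..<l\<^sub>0}" "cauchy_solution d K f (indicator {-l..l}) u" "0 < \<epsilon>"
      then show "\<forall>\<^sub>F t in at_top. AE x in lebesgue. \<bar>u t x\<bar> < \<epsilon>"
        by (intro extinct[of l]) auto
    qed (rule \<open>0 < l\<^sub>0\<close>)
  qed
  with \<open>0 < \<kappa>\<close> show ?thesis by blast
qed

end
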